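(* Let $(X,d)$ be a complete metric space, let $1\le s<\infty$, and let $h\colon[0,\infty)\to[0,\infty)$ be a nondecreasing continuous function with $h(t)>0$ for all $t>0$. Suppose that $$\lim_{t\downarrow0}\frac{h(t)}{t^s}=0$$ and that $\mu\in\mathscr P(X)$ is such that for every $x,y\in\operatorname{supp}\mu$ there exists a curve $\gamma\subset\operatorname{supp}\mu$ connecting $x$ to $y$ with $\mathcal H^s(\gamma)<\infty$. Then the following condition holds: $\operatorname{supp}\mu$ is compact, and for every $x,y\in\operatorname{supp}\mu$ with $x\ne y$ there exist $N\in\mathbb N$ and a sequence $(z_i)_{i=0}^{N+1}\subset\operatorname{supp}\mu$ such that $z_0=x$, $z_{N+1}=y$ and $$\sum_{i=0}^N h(d(z_i,z_{i+1}))<h(d(x,y)).$$ In particular, this condition holds if $h(0)=h'(0)=0$ and if any $x,y\in\operatorname{supp}\mu$ can be connected by a rectifiable curve in $\operatorname{supp}\mu$.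
   Context: $\mathscr P(X)$ is the set of Borel probability measures on $X$; $\operatorname{supp}\mu$ is the support of $\mu$, i.e. the set of $x\in X$ such that every open ball centered at $x$ with positive radius has positive $\mu$-measure. $\mathcal H^s$ denotes the $s$-dimensional Hausdorff measure. A curve is (the image of) a continuous map from a compact interval; $h'(0)$ is the one-sided derivative.
   Formalization: Compactness of supp μ does not follow from the hypotheses (Gaussian on ℝ, s=1, h(t)=t²), so it is assumed rather than concluded in the full condition; the chain property is proved without assuming compactness, in both parts. *)

theory Defs
  imports "HOL-Probability.Probability"
begin

definition measure_support :: "'a::metric_space measure \<Rightarrow> 'a set" where
  "measure_support \<mu> = {x. \<forall>r>0. emeasure \<mu> (ball x r) > 0}"

text \<open>
  Hausdorff measure without a normalising constant. Boundedness of the covering sets is required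
  explicitly since \<^const>\<open>diameter\<close> is a junk value on unbounded sets. A set without countable
  covers of mesh at most \<open>\<delta>\<close> gets the value \<open>\<infinity>\<close>. The definition is intended for
  \<open>s > 0\<close>, because \<open>0 powr 0 = 0\<close>.
\<close>

definition hausdorff_premeasure :: "real \<Rightarrow> real \<Rightarrow> 'a::metric_space set \<Rightarrow> ennreal" where
  "hausdorff_premeasure s \<delta> A =
     (INF E \<in> {E :: nat \<Rightarrow> 'a set. A \<subseteq> (\<Union>i. E i) \<and> (\<forall>i. bounded (E i) \<and> diameter (E i) \<le> \<delta>)}.
        (\<Sum>i. ennreal (diameter (E i) powr s)))"

definition hausdorff_measure :: "real \<Rightarrow> 'a::metric_space set \<Rightarrow> ennreal" where
  "hausdorff_measure s A = (SUP \<delta> \<in> {0<..}. hausdorff_premeasure s \<delta> A)"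

definition curve_length :: "(real \<Rightarrow> 'a::metric_space) \<Rightarrow> ennreal" where
  "curve_length g =
     (SUP (n, t) \<in> {(n :: nat, t :: nat \<Rightarrow> real). mono_on {..n} t \<and> t ` {..n} \<subseteq> {0..1}}.
        ennreal (\<Sum>i<n. dist (g (t i)) (g (t (Suc i)))))"

definition rectifiable :: "(real \<Rightarrow> 'a::metric_space) \<Rightarrow> bool" where
  "rectifiable g \<longleftrightarrow> path g \<and> curve_length g < \<infinity>"

definition cheap_chains :: "(real \<Rightarrow> real) \<Rightarrow> 'a::metric_space set \<Rightarrow> bool" where
  "cheap_chains h S \<longleftrightarrow>
     (\<forall>x\<in>S. \<forall>y\<in>S. x \<noteq> y \<longrightarrow>
        (\<exists>(N::nat) z. (\<forall>i\<le>N+1. z i \<in> S) \<and> z 0 = x \<and> z (N+1) = y \<and>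
           (\<Sum>i=0..N. h (dist (z i) (z (i+1)))) < h (dist x y)))"

definition compact_chain_condition :: "(real \<Rightarrow> real) \<Rightarrow> 'a::metric_space measure \<Rightarrow> bool" where
  "compact_chain_condition h \<mu> \<longleftrightarrow>
     compact (measure_support \<mu>) \<and> cheap_chains h (measure_support \<mu>)"

end

theory Submission
  imports Defs
begin

text \<open>
  Both claims come down to one estimate. Near \<open>0\<close> a gauge \<open>h\<close> with \<open>h t = o(t\<^sup>s)\<close> satisfies
  \<open>h t \<le> \<epsilon> * t\<^sup>s\<close>, so a chain whose links are short and whose \<open>s\<close>-th powers of link lengths have
  sum at most \<open>K\<close> costs at most \<open>\<epsilon> * K\<close>. Since \<open>K\<close> does not depend on \<open>\<epsilon>\<close>, this drops below the
  fixed positive number \<open>h (dist x y)\<close>.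

  When \<open>x\<close> and \<open>y\<close> lie on a curve of finite \<open>\<H>\<^sup>s\<close>-measure, the links come from a cover of the curve
  by sets of small diameter \<open>D i\<close> for which the sum of \<open>D i powr s\<close> is at most \<open>K\<close>. Slightly enlarged,
  these sets become open, so finitely many suffice, and connectedness of the curve lets one walk from
  \<open>x\<close> to \<open>y\<close> using each set for at most one link (\<open>chain_through_open_cover\<close>). When \<open>x\<close> and \<open>y\<close>
  lie on a rectifiable curve, the links come from a fine equidistant subdivision of the parameter
  interval, with \<open>s = 1\<close> and the length of the curve as \<open>K\<close>.
\<close>

section \<open>Chains with a cost bound\<close>

text \<open>
  Carrying the bound as a parameter, instead of comparing with \<open>h (dist x y)\<close>, lets bounds add up
  when a chain is extended.
\<close>

definition chain_below ::
    "(real \<Rightarrow> real) \<Rightarrow> 'a::metric_space set \<Rightarrow> 'a \<Rightarrow> 'a \<Rightarrow> real \<Rightarrow> bool" where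
  "chain_below h S x y c \<longleftrightarrow>
     (\<exists>(N::nat) z. (\<forall>i\<le>N+1. z i \<in> S) \<and> z 0 = x \<and> z (N+1) = y \<and>
        (\<Sum>i=0..N. h (dist (z i) (z (i+1)))) \<le> c)"

lemma chain_below_link:
  assumes "x \<in> S" "y \<in> S" "h (dist x y) \<le> c"
  shows "chain_below h S x y c"
  unfolding chain_below_def
  by (rule exI[of _ 0], rule exI[of _ "\<lambda>i. if i = 0 then x else y"]) (use assms in auto)

lemma chain_below_snoc:
  assumes "chain_below h S x y a" "w \<in> S" "h (dist y w) \<le> b"
  shows "chain_below h S x w (a + b)"
proof -
  obtain N :: nat and z where z: "\<forall>i\<le>N+1. z i \<in> S" "z 0 = x" "z (N+1) = y"
      "(\<Sum>i=0..N. h (dist (z i) (z (i+1)))) \<le> a"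
    using assms(1) unfolding chain_below_def by blast
  define z' where "z' = z(N+2 := w)"
  have "(\<Sum>i=0..N+1. h (dist (z' i) (z' (i+1))))
      = (\<Sum>i=0..N. h (dist (z' i) (z' (i+1)))) + h (dist (z' (N+1)) (z' (N+2)))"
    by simp
  also have "(\<Sum>i=0..N. h (dist (z' i) (z' (i+1)))) = (\<Sum>i=0..N. h (dist (z i) (z (i+1))))"
    by (rule sum.cong) (auto simp: z'_def)
  also have "h (dist (z' (N+1)) (z' (N+2))) = h (dist y w)"
    using z(3) by (simp add: z'_def)
  finally have "(\<Sum>i=0..N+1. h (dist (z' i) (z' (i+1)))) \<le> a + b"
    using z(4) assms(3) by linarith
  moreover have "\<forall>i\<le>(N+1)+1. z' i \<in> S"
    using z(1) assms(2) by (auto simp: z'_def le_Suc_eq)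
  moreover have "z' 0 = x" "z' ((N+1)+1) = w"
    using z(2) by (auto simp: z'_def)
  ultimately show ?thesis
    unfolding chain_below_def by blast
qed

lemma chain_below_mono:
  assumes "chain_below h S x y a" "S \<subseteq> T" "a \<le> b"
  shows "chain_below h T x y b"
proof -
  obtain N :: nat and z where "\<forall>i\<le>N+1. z i \<in> S" "z 0 = x" "z (N+1) = y"
      "(\<Sum>i=0..N. h (dist (z i) (z (i+1)))) \<le> a"
    using assms(1) unfolding chain_below_def by blast
  then show ?thesis
    unfolding chain_below_def using assms(2,3)
    by (intro exI[of _ N] exI[of _ z]) (meson in_mono order_trans)
qed

lemma cheap_chainsI:
  assumes "\<And>x y. x \<in> S \<Longrightarrow> y \<in> S \<Longrightarrow> x \<noteq> y \<Longrightarrow> \<exists>c<h (dist x y). chain_below h S x y c"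
  shows "cheap_chains h S"
  unfolding cheap_chains_def
proof (intro ballI impI)
  fix x y assume "x \<in> S" "y \<in> S" "x \<noteq> y"
  then obtain c z and N :: nat where "c < h (dist x y)" "\<forall>i\<le>N+1. z i \<in> S" "z 0 = x" "z (N+1) = y"
      "(\<Sum>i=0..N. h (dist (z i) (z (i+1)))) \<le> c"
    using assms unfolding chain_below_def by blast
  then show "\<exists>(N::nat) z. (\<forall>i\<le>N+1. z i \<in> S) \<and> z 0 = x \<and> z (N+1) = y \<and>
      (\<Sum>i=0..N. h (dist (z i) (z (i+1)))) < h (dist x y)"
    by (intro exI[of _ N] exI[of _ z]) simp
qed

section \<open>Chains through finite open covers of connected sets\<close>

text \<open>
  Call a set \<open>J\<close> of indices reached if every point of \<open>S\<close> in one of the \<open>U j\<close> with \<open>j \<in> J\<close> is the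
  end of a chain from \<open>x\<close> of cost at most the sum of \<open>c\<close> over \<open>J\<close>. A reached set stays reached when an
  index is added whose set meets those already present, at the price of one more link. A maximal reached
  set therefore splits \<open>S\<close> into two relatively open parts, and connectedness makes the second part
  empty. Growing the index set, and not the chain itself, pays for every index only once although
  nothing is said about the chains being free of repetitions.
\<close>

lemma chain_through_open_cover:
  fixes S :: "'a::metric_space set"
  assumes S: "connected S" and x: "x \<in> S" and y: "y \<in> S"
    and I: "finite I" and U: "\<And>i. i \<in> I \<Longrightarrow> open (U i)" and cover: "S \<subseteq> (\<Union>i\<in>I. U i)"
    and c: "\<And>i. i \<in> I \<Longrightarrow> 0 \<le> c i"
    and cost: "\<And>i u v. i \<in> I \<Longrightarrow> u \<in> U i \<Longrightarrow> v \<in> U i \<Longrightarrow> h (dist u v) \<le> c i"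
  shows "chain_below h S x y (\<Sum>i\<in>I. c i)"
proof -
  define reached where "reached J \<longleftrightarrow> J \<subseteq> I \<and> x \<in> (\<Union>j\<in>J. U j) \<and>
    (\<forall>z\<in>S. z \<in> (\<Union>j\<in>J. U j) \<longrightarrow> chain_below h S x z (\<Sum>j\<in>J. c j))" for J
  have "\<exists>i0\<in>I. x \<in> U i0" using x cover by blast
  then obtain i0 where i0: "i0 \<in> I" "x \<in> U i0" by blast
  have "reached {i0}"
    unfolding reached_def using i0 x by (auto intro!: chain_below_link cost)
  moreover have fin: "finite {J. reached J}"
    by (rule finite_subset[of _ "Pow I"]) (auto simp: reached_def I)
  ultimately obtain J where J: "reached J" and max: "\<And>J'. reached J' \<Longrightarrow> J \<subseteq> J' \<Longrightarrow> J' = J"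
    using finite_has_maximal[of "{J. reached J}"] by blast
  have JI: "J \<subseteq> I" and xJ: "x \<in> (\<Union>j\<in>J. U j)"
    and chain: "\<And>z. z \<in> S \<Longrightarrow> z \<in> (\<Union>j\<in>J. U j) \<Longrightarrow> chain_below h S x z (\<Sum>j\<in>J. c j)"
    using J unfolding reached_def by blast+
  have finJ: "finite J" using JI I finite_subset by blast
  have disj: "u \<notin> U i" if i: "i \<in> I - J" and u: "u \<in> S" "u \<in> (\<Union>j\<in>J. U j)" for i u
  proof
    assume ui: "u \<in> U i"
    have sum: "(\<Sum>j\<in>insert i J. c j) = (\<Sum>j\<in>J. c j) + c i"
      using i finJ by simp
    have "chain_below h S x z (\<Sum>j\<in>insert i J. c j)"
      if z: "z \<in> S" "z \<in> (\<Union>j\<in>insert i J. U j)" for z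
    proof (cases "z \<in> (\<Union>j\<in>J. U j)")
      case True
      show ?thesis
        by (rule chain_below_mono[OF chain[OF z(1) True]]) (use c i sum in auto)
    next
      case False
      then have "z \<in> U i" using z by blast
      then have "h (dist u z) \<le> c i" using cost i ui by blast
      then show ?thesis
        using chain_below_snoc[OF chain[OF u] z(1)] sum by simp
    qed
    then have "reached (insert i J)"
      unfolding reached_def using JI i xJ by auto
    then have "insert i J = J"
      by (rule max) blast
    then show False using i by blast
  qed
  have "(\<Union>j\<in>J. U j) \<inter> S = {} \<or> (\<Union>j\<in>I-J. U j) \<inter> S = {}"
  proof (rule connectedD[OF S])
    show "open (\<Union>j\<in>J. U j)" "open (\<Union>j\<in>I-J. U j)" using U JI by blast+
    show "(\<Union>j\<in>J. U j) \<inter> (\<Union>j\<in>I-J. U j) \<inter> S = {}" using disj by blast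
    show "S \<subseteq> (\<Union>j\<in>J. U j) \<union> (\<Union>j\<in>I-J. U j)" using cover by blast
  qed
  then have "(\<Union>j\<in>I-J. U j) \<inter> S = {}" using x xJ by blast
  then have "y \<in> (\<Union>j\<in>J. U j)" using y cover by blast
  then have "chain_below h S x y (\<Sum>j\<in>J. c j)" using chain y by blast
  moreover have "(\<Sum>j\<in>J. c j) \<le> (\<Sum>j\<in>I. c j)"
    by (rule sum_mono2) (use I JI c in auto)
  ultimately show ?thesis
    using chain_below_mono by blast
qed

section \<open>Chains along sets of finite Hausdorff measure\<close>

text \<open>
  The inequality is needed at \<open>t = 0\<close> as well, since covers may contain singletons and chains may
  stand still. There it holds because \<open>h\<close> tends to \<open>0\<close> from the
  right, so that continuity forces \<open>h 0 = 0\<close>.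
\<close>

lemma gauge_le_powr_near_0:
  fixes h :: "real \<Rightarrow> real"
  assumes s: "s > 0" and cont: "continuous_on {0..} h"
    and lim: "((\<lambda>t. h t / t powr s) \<longlongrightarrow> 0) (at_right 0)" and e: "e > 0"
  obtains \<delta> where "\<delta> > 0" "\<And>t. 0 \<le> t \<Longrightarrow> t \<le> \<delta> \<Longrightarrow> h t \<le> e * t powr s"
proof -
  have pow: "((\<lambda>t::real. t powr s) \<longlongrightarrow> 0) (at_right 0)"
    using s by real_asymp
  have "((\<lambda>t. h t / t powr s * t powr s) \<longlongrightarrow> 0 * 0) (at_right 0)"
    by (intro tendsto_mult lim pow)
  then have "((\<lambda>t. h t / t powr s * t powr s) \<longlongrightarrow> 0) (at_right 0)"
    by simp
  then have "(h \<longlongrightarrow> 0) (at_right 0)"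
    by (rule Lim_transform_eventually) (rule eventually_at_rightI[of 0 1], auto)
  moreover have "(h \<longlongrightarrow> h 0) (at_right 0)"
    using cont by (auto simp: continuous_on_def intro: tendsto_within_subset)
  ultimately have h0: "h 0 = 0"
    using tendsto_unique trivial_limit_at_right_real by blast
  have "eventually (\<lambda>t. h t / t powr s < e) (at_right 0)"
    using order_tendstoD(2)[OF lim e] .
  then obtain b where b: "b > 0" "\<And>t. 0 < t \<Longrightarrow> t < b \<Longrightarrow> h t / t powr s < e"
    unfolding eventually_at_right_field by blast
  show thesis
  proof (rule that[of "b/2"])
    show "b/2 > 0" using b by simp
    fix t assume t: "0 \<le> t" "t \<le> b/2"
    show "h t \<le> e * t powr s"
    proof (cases "t = 0")
      case True
      then show ?thesis by (simp add: h0)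
    next
      case False
      then show ?thesis
        using b(2)[of t] b(1) t by (simp add: field_simps)
    qed
  qed
qed

lemma hausdorff_measure_cover:
  assumes "hausdorff_measure s A < K" "\<delta> > 0"
  obtains E :: "nat \<Rightarrow> 'a::metric_space set"
  where "A \<subseteq> (\<Union>i. E i)" "\<And>i. bounded (E i)" "\<And>i. diameter (E i) \<le> \<delta>"
    "(\<Sum>i. ennreal (diameter (E i) powr s)) < K"
proof -
  have "hausdorff_premeasure s \<delta> A \<le> hausdorff_measure s A"
    unfolding hausdorff_measure_def using assms(2) by (intro SUP_upper) auto
  then have "hausdorff_premeasure s \<delta> A < K"
    using assms(1) by (rule le_less_trans)
  then show thesis
    unfolding hausdorff_premeasure_def INF_less_iff using that by blast
qed

text \<open>
  The covering sets need not be open. Continuity of \<open>h\<close> allows the \<open>i\<close>-th set to be thickened so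
  little that its cost grows by at most \<open>e / 2 ^ i\<close>, hence by at most \<open>2 * e\<close> in total.
\<close>

lemma chain_below_of_hausdorff_measure_finite:
  fixes C :: "'a::metric_space set"
  assumes s: "s > 0" and h_nonneg: "\<And>t. 0 \<le> t \<Longrightarrow> 0 \<le> h t" and h_mono: "mono_on {0..} h"
    and h_cont: "continuous_on {0..} h"
    and lim: "((\<lambda>t. h t / t powr s) \<longlongrightarrow> 0) (at_right 0)"
    and C: "compact C" "connected C" "hausdorff_measure s C < \<infinity>"
    and xy: "x \<in> C" "y \<in> C" and \<eta>: "\<eta> > 0"
  shows "chain_below h C x y \<eta>"
proof -
  obtain m where m: "m \<ge> 0" "hausdorff_measure s C = ennreal m"
    using C(3) by (cases "hausdorff_measure s C") auto
  define K where "K = m + 1"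
  have K: "K > 0" "hausdorff_measure s C < ennreal K"
    unfolding K_def using m by (auto intro!: ennreal_lessI)
  define e where "e = \<eta> / (K + 2)"
  have e: "e > 0" unfolding e_def using \<eta> K by simp
  obtain \<delta> where \<delta>: "\<delta> > 0" "\<And>t. 0 \<le> t \<Longrightarrow> t \<le> \<delta> \<Longrightarrow> h t \<le> e * t powr s"
    using gauge_le_powr_near_0[OF s h_cont lim e] by blast
  obtain E where E: "C \<subseteq> (\<Union>i. E i)" "\<And>i. bounded (E i)" "\<And>i. diameter (E i) \<le> \<delta>"
      and Esum: "(\<Sum>i. ennreal (diameter (E i) powr s)) < K"
    using hausdorff_measure_cover[OF K(2) \<delta>(1)] by blast
  define D where "D i = diameter (E i)" for i
  have D0: "D i \<ge> 0" for i unfolding D_def using E(2) diameter_ge_0 by blast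
  have "\<exists>r>0. h (D i + 2 * r) \<le> h (D i) + e * (1/2)^i" for i
  proof -
    have "e * (1/2)^i > 0" using e by simp
    then obtain \<rho> where \<rho>: "\<rho> > 0" "\<And>t. t \<in> {0..} \<Longrightarrow> dist t (D i) < \<rho> \<Longrightarrow> dist (h t) (h (D i)) < e * (1/2)^i"
      using h_cont D0[of i] unfolding continuous_on_iff by (metis atLeast_iff)
    have "dist (h (D i + 2 * (\<rho>/4))) (h (D i)) < e * (1/2)^i"
      by (rule \<rho>(2)) (use D0[of i] \<rho>(1) in \<open>auto simp: dist_real_def\<close>)
    then show ?thesis
      using \<rho>(1) by (intro exI[of _ "\<rho>/4"]) (auto simp: dist_real_def)
  qed
  then obtain r where r: "\<And>i. r i > 0" "\<And>i. h (D i + 2 * r i) \<le> h (D i) + e * (1/2)^i"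
    by metis
  define U where "U i = (\<Union>a\<in>E i. ball a (r i))" for i
  have Uopen: "open (U i)" for i unfolding U_def by blast
  have EU: "E i \<subseteq> U i" for i unfolding U_def using r(1) by auto
  obtain I where I: "finite I" "C \<subseteq> (\<Union>i\<in>I. U i)"
    using compactE_image[OF C(1), of UNIV U] Uopen E(1) EU by (metis (no_types, lifting) SUP_mono UNIV_I order_trans)
  have cost: "h (dist u v) \<le> h (D i + 2 * r i)" if uv: "u \<in> U i" "v \<in> U i" for i u v
  proof -
    obtain a b where ab: "a \<in> E i" "b \<in> E i" "dist a u < r i" "dist b v < r i"
      using uv unfolding U_def by auto
    have "dist a b \<le> D i"
      unfolding D_def using diameter_bounded_bound[OF E(2) ab(1,2)] .
    then have "dist u v \<le> D i + 2 * r i"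
      using dist_triangle[of u v a] dist_triangle[of a v b] ab(3,4) by (simp add: dist_commute)
    then show ?thesis
      using mono_onD[OF h_mono, of "dist u v" "D i + 2 * r i"] zero_le_dist[of u v] by simp
  qed
  have "chain_below h C x y (\<Sum>i\<in>I. h (D i + 2 * r i))"
  proof (rule chain_through_open_cover[OF C(2) xy I(1) _ I(2)])
    show "open (U i)" for i by (rule Uopen)
    show "0 \<le> h (D i + 2 * r i)" for i
      using h_nonneg D0[of i] r(1)[of i] by simp
    show "h (dist u v) \<le> h (D i + 2 * r i)" if "u \<in> U i" "v \<in> U i" for i u v
      using cost that .
  qed
  moreover have "(\<Sum>i\<in>I. h (D i + 2 * r i)) \<le> \<eta>"
  proof -
    have "ennreal (\<Sum>i\<in>I. D i powr s) = (\<Sum>i\<in>I. ennreal (D i powr s))"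
      by (rule sum_ennreal[symmetric]) simp
    also have "\<dots> \<le> (\<Sum>i. ennreal (D i powr s))"
      by (rule sum_le_suminf) (use I(1) in auto)
    also have "\<dots> < ennreal K" using Esum unfolding D_def .
    finally have sumD: "(\<Sum>i\<in>I. D i powr s) \<le> K"
      using K(1) by (simp add: ennreal_less_iff sum_nonneg)
    have "(\<Sum>i\<in>I. (1/2)^i) \<le> (\<Sum>i. (1/2::real)^i)"
      by (rule sum_le_suminf) (use I(1) in \<open>auto intro: summable_geometric\<close>)
    also have "\<dots> = 2" by (subst suminf_geometric) auto
    finally have geo: "(\<Sum>i\<in>I. (1/2::real)^i) \<le> 2" .
    have "(\<Sum>i\<in>I. h (D i + 2 * r i)) \<le> (\<Sum>i\<in>I. e * D i powr s + e * (1/2)^i)"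
    proof (rule sum_mono)
      fix i
      have "h (D i) \<le> e * D i powr s"
        by (rule \<delta>(2)[OF D0]) (use E(3) in \<open>simp add: D_def\<close>)
      then show "h (D i + 2 * r i) \<le> e * D i powr s + e * (1/2)^i"
        using r(2)[of i] by linarith
    qed
    also have "\<dots> = e * ((\<Sum>i\<in>I. D i powr s) + (\<Sum>i\<in>I. (1/2)^i))"
      by (simp add: sum.distrib sum_distrib_left distrib_left)
    also have "\<dots> \<le> e * (K + 2)"
      using sumD geo e by (intro mult_left_mono add_mono) auto
    also have "\<dots> = \<eta>" unfolding e_def using K(1) by simp
    finally show ?thesis .
  qed
  ultimately show ?thesis
    using chain_below_mono by blast
qed

section \<open>Chains along rectifiable curves\<close>

lemma sum_dist_le_curve_length:
  assumes "mono_on {..n} t" "t ` {..n} \<subseteq> {0..1}"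
  shows "ennreal (\<Sum>i<n. dist (g (t i)) (g (t (Suc i)))) \<le> curve_length g"
  unfolding curve_length_def
  by (rule SUP_upper2[of "(n, t)"]) (use assms in auto)

text \<open>
  Uniform continuity turns a fine equidistant subdivision of \<open>{0..1}\<close> into a chain with short links,
  and the sum of its link lengths is bounded by the length of the curve.
\<close>

lemma chain_below_of_rectifiable:
  fixes g :: "real \<Rightarrow> 'a::metric_space"
  assumes h_cont: "continuous_on {0..} h"
    and lim: "((\<lambda>t. h t / t powr 1) \<longlongrightarrow> 0) (at_right 0)"
    and g: "rectifiable g" and \<eta>: "\<eta> > 0"
  shows "chain_below h (path_image g) (pathstart g) (pathfinish g) \<eta>"
proof -
  have "path g" and fin: "curve_length g < \<infinity>"
    using g unfolding rectifiable_def by auto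
  obtain L where L: "L \<ge> 0" "curve_length g = ennreal L"
    using fin by (cases "curve_length g") auto
  define e where "e = \<eta> / (L + 1)"
  have e: "e > 0" unfolding e_def using \<eta> L by simp
  obtain \<delta> where \<delta>: "\<delta> > 0" "\<And>t. 0 \<le> t \<Longrightarrow> t \<le> \<delta> \<Longrightarrow> h t \<le> e * t powr 1"
    using gauge_le_powr_near_0[OF zero_less_one h_cont lim e] by blast
  have "uniformly_continuous_on {0..1} g"
    using \<open>path g\<close> unfolding path_def by (simp add: compact_uniformly_continuous)
  then obtain \<rho> where \<rho>: "\<rho> > 0"
      "\<And>a b. a \<in> {0..1} \<Longrightarrow> b \<in> {0..1} \<Longrightarrow> dist b a < \<rho> \<Longrightarrow> dist (g b) (g a) < \<delta>"
    using \<delta>(1) unfolding uniformly_continuous_on_def by metis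
  obtain N :: nat where N: "1 / real (Suc N) < \<rho>"
    using \<rho>(1) nat_approx_posE by blast
  define t where "t i = real i / real (Suc N)" for i
  have t01: "t i \<in> {0..1}" if "i \<le> Suc N" for i
    using that unfolding t_def by (auto simp: divide_simps)
  have tdiff: "dist (t i) (t (Suc i)) < \<rho>" for i
    using N unfolding t_def dist_real_def by (simp add: diff_divide_distrib[symmetric])
  have short: "dist (g (t i)) (g (t (Suc i))) < \<delta>" if "i \<le> N" for i
    by (rule \<rho>(2)) (use that t01 tdiff in auto)
  have "ennreal (\<Sum>i<Suc N. dist (g (t i)) (g (t (Suc i)))) \<le> ennreal L"
    unfolding L(2)[symmetric]
    by (rule sum_dist_le_curve_length)
       (use t01 in \<open>auto simp: mono_on_def t_def intro!: divide_right_mono\<close>)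
  then have len: "(\<Sum>i=0..N. dist (g (t i)) (g (t (Suc i)))) \<le> L"
    using L(1) by (simp add: ennreal_le_iff lessThan_Suc_atMost atLeast0AtMost)
  have "(\<Sum>i=0..N. h (dist (g (t i)) (g (t (Suc i)))))
      \<le> (\<Sum>i=0..N. e * dist (g (t i)) (g (t (Suc i))))"
  proof (rule sum_mono)
    fix i assume "i \<in> {0..N}"
    then show "h (dist (g (t i)) (g (t (Suc i)))) \<le> e * dist (g (t i)) (g (t (Suc i)))"
      using \<delta>(2)[of "dist (g (t i)) (g (t (Suc i)))"] short[of i] by simp
  qed
  also have "\<dots> = e * (\<Sum>i=0..N. dist (g (t i)) (g (t (Suc i))))"
    by (simp add: sum_distrib_left)
  also have "\<dots> \<le> e * (L + 1)"
    using len e by (intro mult_left_mono) auto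
  also have "\<dots> = \<eta>" unfolding e_def using L(1) by simp
  finally have "(\<Sum>i=0..N. h (dist (g (t i)) (g (t (i+1))))) \<le> \<eta>" by simp
  moreover have "\<forall>i\<le>N+1. g (t i) \<in> path_image g"
    using t01 unfolding path_image_def by simp
  moreover have "g (t 0) = pathstart g" "g (t (N+1)) = pathfinish g"
    unfolding t_def pathstart_def pathfinish_def by simp_all
  ultimately show ?thesis
    unfolding chain_below_def by (intro exI[of _ N] exI[of _ "\<lambda>i. g (t i)"]) blast
qed

section \<open>Cheap chains in the support of a measure\<close>

theorem proposition3p5:
  fixes \<mu> :: "'a::complete_space measure" and h :: "real \<Rightarrow> real" and s :: real
  assumes s: "1 \<le> s"
    and h_nonneg: "\<And>t. 0 \<le> t \<Longrightarrow> 0 \<le> h t"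
    and h_mono: "mono_on {0..} h"
    and h_cont: "continuous_on {0..} h"
    and h_pos: "\<And>t. 0 < t \<Longrightarrow> 0 < h t"
    and \<mu>_prob: "prob_space \<mu>"
    and \<mu>_borel: "sets \<mu> = sets borel"
  shows "(((\<lambda>t. h t / t powr s) \<longlongrightarrow> 0) (at_right 0) \<and>
          (\<forall>x\<in>measure_support \<mu>. \<forall>y\<in>measure_support \<mu>.
             \<exists>g. path g \<and> pathstart g = x \<and> pathfinish g = y \<and>
                 path_image g \<subseteq> measure_support \<mu> \<and>
                 hausdorff_measure s (path_image g) < \<infinity>)
          \<longrightarrow> cheap_chains h (measure_support \<mu>) \<and>
              (compact (measure_support \<mu>) \<longrightarrow> compact_chain_condition h \<mu>))
       \<and> (h 0 = 0 \<and> (h has_real_derivative 0) (at 0 within {0..}) \<and>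
          (\<forall>x\<in>measure_support \<mu>. \<forall>y\<in>measure_support \<mu>.
             \<exists>g. rectifiable g \<and> pathstart g = x \<and> pathfinish g = y \<and>
                 path_image g \<subseteq> measure_support \<mu>)
          \<longrightarrow> cheap_chains h (measure_support \<mu>) \<and>
              (compact (measure_support \<mu>) \<longrightarrow> compact_chain_condition h \<mu>))"
proof -
  have chains: "cheap_chains h S"
    if "\<And>x y \<eta>. x \<in> S \<Longrightarrow> y \<in> S \<Longrightarrow> \<eta> > 0 \<Longrightarrow> chain_below h S x y \<eta>" for S :: "'a set"
  proof (rule cheap_chainsI)
    fix x y assume "x \<in> S" "y \<in> S" "x \<noteq> y"
    then show "\<exists>c<h (dist x y). chain_below h S x y c"
      using that h_pos[of "dist x y"] by (intro exI[of _ "h (dist x y) / 2"]) auto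
  qed
  have "cheap_chains h (measure_support \<mu>)"
    if lim: "((\<lambda>t. h t / t powr s) \<longlongrightarrow> 0) (at_right 0)"
      and conn: "\<forall>x\<in>measure_support \<mu>. \<forall>y\<in>measure_support \<mu>.
        \<exists>g. path g \<and> pathstart g = x \<and> pathfinish g = y \<and>
            path_image g \<subseteq> measure_support \<mu> \<and> hausdorff_measure s (path_image g) < \<infinity>"
  proof (rule chains)
    fix x y and \<eta> :: real
    assume "x \<in> measure_support \<mu>" "y \<in> measure_support \<mu>" and \<eta>: "\<eta> > 0"
    then obtain g where g: "path g" "pathstart g = x" "pathfinish g = y"
        "path_image g \<subseteq> measure_support \<mu>" "hausdorff_measure s (path_image g) < \<infinity>"
      using conn by blast
    have "chain_below h (path_image g) x y \<eta>"
      by (rule chain_below_of_hausdorff_measure_finite[OF _ h_nonneg h_mono h_cont lim _ _ g(5) _ _ \<eta>])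
         (use s g in \<open>auto simp: compact_path_image connected_path_image\<close>)
    then show "chain_below h (measure_support \<mu>) x y \<eta>"
      using chain_below_mono g(4) by blast
  qed
  moreover have "cheap_chains h (measure_support \<mu>)"
    if h0: "h 0 = 0" and deriv: "(h has_real_derivative 0) (at 0 within {0..})"
      and conn: "\<forall>x\<in>measure_support \<mu>. \<forall>y\<in>measure_support \<mu>.
        \<exists>g. rectifiable g \<and> pathstart g = x \<and> pathfinish g = y \<and> path_image g \<subseteq> measure_support \<mu>"
  proof (rule chains)
    fix x y and \<eta> :: real
    assume "x \<in> measure_support \<mu>" "y \<in> measure_support \<mu>" and \<eta>: "\<eta> > 0"
    then obtain g where g: "rectifiable g" "pathstart g = x" "pathfinish g = y"
        "path_image g \<subseteq> measure_support \<mu>"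
      using conn by blast
    have "((\<lambda>t. h t / t) \<longlongrightarrow> 0) (at 0 within {0..})"
      using deriv h0 by (simp add: has_field_derivative_iff)
    then have "((\<lambda>t. h t / t) \<longlongrightarrow> 0) (at_right 0)"
      by (rule tendsto_within_subset) auto
    then have "((\<lambda>t. h t / t powr 1) \<longlongrightarrow> 0) (at_right 0)"
      by (rule Lim_transform_eventually) (auto intro: eventually_at_rightI[of 0 1])
    then have "chain_below h (path_image g) x y \<eta>"
      using chain_below_of_rectifiable[OF h_cont _ g(1) \<eta>] g(2,3) by simp
    then show "chain_below h (measure_support \<mu>) x y \<eta>"
      using chain_below_mono g(4) by blast
  qed
  ultimately show ?thesis
    unfolding compact_chain_condition_def by blast
qed

end
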